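(* For every integer $t\ge 3$ there exist a constant $c>0$ and an integer $n_0$ such that for every integer $n\ge n_0$ there exists a state $(a_1,a_2,\dots,a_t)$ with $a_1+a_2+\cdots+a_t=n$ for which emptying a vessel requires at least $c\log n$ pouring steps; that is, for each fixed $t\ge 3$ and all sufficiently large $n$ there is a state with $t$ vessels and total content $n$ for which solving the pouring problem needs $\Omega(\log n)$ pouring steps.
   Context: A state with $t$ vessels is a vector $(a_1,\dots,a_t)$ of non-negative integers (the contents of the vessels). A pouring step chooses two distinct vessels with contents $x$ and $y$, where $x\le y$, and replaces these contents by $2x$ (for the vessel that contained $x$) and $y-x$ (for the vessel that contained $y$); all other contents are unchanged. Emptying a vessel means reaching, by a sequence of pouring steps, a state in which at least one vessel has content $0$; solving the pouring problem means doing so. $\log$ denotes $\log_2$. *)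

theory Defs
  imports Complex_Main
begin

(* A state with t vessels is a list of length t. *)
inductive pour :: "nat list \<Rightarrow> nat list \<Rightarrow> bool" where
  "i < length a \<Longrightarrow> j < length a \<Longrightarrow> i \<noteq> j \<Longrightarrow> a ! i \<le> a ! j \<Longrightarrow>
     pour a (a[i := 2 * a ! i, j := a ! j - a ! i])"

definition has_empty_vessel :: "nat list \<Rightarrow> bool" where
  "has_empty_vessel a \<longleftrightarrow> (\<exists>i < length a. a ! i = 0)"

definition emptying_requires :: "nat list \<Rightarrow> real \<Rightarrow> bool" where
  "emptying_requires a r \<longleftrightarrow>
     (\<forall>k b. (pour ^^ k) a b \<longrightarrow> has_empty_vessel b \<longrightarrow> r \<le> real k)"

end

theory Submission
  imports Defs
begin

text \<open>
  A pouring step is linear in the contents, so a sequence of \<open>k\<close> steps that empties a vessel of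
  \<open>a\<close> gives a nonzero integer functional vanishing at \<open>a\<close>, and at most \<open>t ^ (2 * k + 1)\<close>
  functionals arise in this way. Take the states \<open>(n - x - x\<^sup>2 - \<dots>, x, x\<^sup>2, \<dots>, x ^ (t - 1))\<close>:
  on this curve a nonzero functional is a nonzero polynomial in \<open>x\<close> of degree less than \<open>t\<close>,
  so all the functionals together vanish at no more than \<open>t ^ (2 * k + 2)\<close> of these states.
  If \<open>k\<close> is a small multiple of \<open>log n\<close>, a state avoiding them all remains.
\<close>

text \<open>
  The pull-backs of the coordinate functionals along at most \<open>k\<close> pouring steps.
  Admitting \<open>i = j\<close>, which changes nothing, makes the family increasing in \<open>k\<close>.
\<close>
fun pullbacks :: "nat \<Rightarrow> nat \<Rightarrow> (nat \<Rightarrow> int) set" where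
  "pullbacks t 0 = (\<lambda>i. (\<lambda>_. 0)(i := 1)) ` {..<t}"
| "pullbacks t (Suc k) =
     (\<lambda>(r, i, j). r(i := 2 * r i - r j)) ` (pullbacks t k \<times> {..<t} \<times> {..<t})"

lemma finite_pullbacks: "finite (pullbacks t k)"
  by (induction k) auto

lemma card_pullbacks: "card (pullbacks t k) \<le> t ^ (2 * k + 1)"
proof (induction k)
  case 0
  show ?case using card_image_le[of "{..<t}"] by simp
next
  case (Suc k)
  have "card (pullbacks t (Suc k)) \<le> card (pullbacks t k \<times> {..<t} \<times> {..<t})"
    unfolding pullbacks.simps by (intro card_image_le) (simp add: finite_pullbacks)
  also have "\<dots> = card (pullbacks t k) * t\<^sup>2"
    by (simp add: card_cartesian_product power2_eq_square)
  also have "\<dots> \<le> t ^ (2 * k + 1) * t\<^sup>2" using Suc by simp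
  also have "\<dots> = t ^ (2 * Suc k + 1)" by (simp add: power2_eq_square)
  finally show ?case .
qed

lemma pullbacks_nonzero: "r \<in> pullbacks t k \<Longrightarrow> \<exists>i<t. r i \<noteq> 0"
proof (induction k arbitrary: r)
  case 0
  then show ?case by auto
next
  case (Suc k)
  then obtain s i j where s: "s \<in> pullbacks t k" "i < t" "j < t"
    and r: "r = s(i := 2 * s i - s j)" by auto
  from Suc.IH[OF s(1)] obtain l where l: "l < t" "s l \<noteq> 0" by blast
  \<comment> \<open>The critical case is \<open>l = i\<close> with \<open>2 * s i - s j = 0\<close>:
    then \<open>s j = 2 * s i\<close> is nonzero, so \<open>j\<close> differs from \<open>i\<close>
    and its coefficient survives.\<close>
  have "r l \<noteq> 0 \<or> r j \<noteq> 0" using l r by (auto simp: fun_upd_apply)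
  then show ?case using l s by blast
qed

lemma pullbacks_mono: "k \<le> l \<Longrightarrow> pullbacks t k \<subseteq> pullbacks t l"
proof (rule lift_Suc_mono_le[of "pullbacks t"])
  fix n
  show "pullbacks t n \<subseteq> pullbacks t (Suc n)"
  proof
    fix r assume r: "r \<in> pullbacks t n"
    then obtain i where i: "i < t" using pullbacks_nonzero by blast
    have "r = (\<lambda>(r, i, j). r(i := 2 * r i - r j)) (r, i, i)" by simp
    then show "r \<in> pullbacks t (Suc n)" using r i unfolding pullbacks.simps by blast
  qed
qed

text \<open>The value \<open>r i * (2 * a ! i) + r j * (a ! j - a ! i)\<close> regroups as
  \<open>(2 * r i - r j) * a ! i + r j * a ! j\<close>, so only the coefficient at \<open>i\<close>
  changes. The condition \<open>a ! i \<le> a ! j\<close> makes the subtraction of naturals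
  exact.\<close>

lemma pour_pullback:
  assumes "pour a b" "length b = t" "r \<in> pullbacks t k"
  shows "length a = t \<and>
    (\<exists>s \<in> pullbacks t (Suc k). (\<Sum>l<t. s l * int (a ! l)) = (\<Sum>l<t. r l * int (b ! l)))"
  using assms(1)
proof cases
  case (1 i j)
  have len: "length a = t" using 1 assms(2) by simp
  let ?s = "r(i := 2 * r i - r j)"
  have "?s = (\<lambda>(r, i, j). r(i := 2 * r i - r j)) (r, i, j)" by simp
  then have "?s \<in> pullbacks t (Suc k)"
    using assms(3) 1 len unfolding pullbacks.simps by blast
  moreover have "(\<Sum>l<t. ?s l * int (a ! l)) = (\<Sum>l<t. r l * int (b ! l))"
  proof -
    have split: "(\<Sum>l<t. g l) = g i + g j + (\<Sum>l\<in>{..<t} - {i, j}. g l)" for g :: "nat \<Rightarrow> int"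
    proof -
      have "(\<Sum>l<t. g l) = (\<Sum>l\<in>{i, j}. g l) + (\<Sum>l\<in>{..<t} - {i, j}. g l)"
        using 1 len by (subst add.commute, intro sum.subset_diff) auto
      then show ?thesis using 1 by simp
    qed
    have "(\<Sum>l\<in>{..<t} - {i, j}. ?s l * int (a ! l)) = (\<Sum>l\<in>{..<t} - {i, j}. r l * int (b ! l))"
      using 1 by (intro sum.cong) auto
    moreover have "?s i * int (a ! i) + ?s j * int (a ! j) = r i * int (b ! i) + r j * int (b ! j)"
      using 1 by (simp add: of_nat_diff algebra_simps)
    ultimately show ?thesis unfolding split by simp
  qed
  ultimately show ?thesis using len by blast
qed

lemma pour_length: "pour a b \<Longrightarrow> length b = length a"
  by (auto elim: pour.cases)

lemma pours_length: "(pour ^^ k) a b \<Longrightarrow> length b = length a"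
  by (induction k arbitrary: b) (auto dest: pour_length)

text \<open>The last step is pulled back first, hence the induction generalises over
  \<open>b\<close>, \<open>r\<close> and \<open>l\<close>.\<close>

lemma pours_pullback:
  assumes "(pour ^^ k) a b" "length a = t" "r \<in> pullbacks t l"
  shows "\<exists>s \<in> pullbacks t (k + l). (\<Sum>i<t. s i * int (a ! i)) = (\<Sum>i<t. r i * int (b ! i))"
  using assms
proof (induction k arbitrary: b r l)
  case 0
  then show ?case by auto
next
  case (Suc k)
  from Suc.prems(1) obtain c where c: "(pour ^^ k) a c" "pour c b" by auto
  have "length b = t" using c Suc.prems(2) pours_length pour_length by metis
  from pour_pullback[OF c(2) this Suc.prems(3)] obtain s where s: "s \<in> pullbacks t (Suc l)"
    "(\<Sum>i<t. s i * int (c ! i)) = (\<Sum>i<t. r i * int (b ! i))" by blast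
  from Suc.IH[OF c(1) Suc.prems(2) s(1)] s(2) show ?case by simp
qed

text \<open>The coordinate functional of the empty vessel vanishes at \<open>b\<close>, and pulling
  it back along the run preserves this value.\<close>

lemma emptied_pullback:
  assumes "(pour ^^ k) a b" "has_empty_vessel b" "length a = t"
  shows "\<exists>s \<in> pullbacks t k. (\<Sum>i<t. s i * int (a ! i)) = 0"
proof -
  from assms obtain i where i: "i < t" "b ! i = 0"
    unfolding has_empty_vessel_def using pours_length by metis
  let ?e = "(\<lambda>_. 0 :: int)(i := 1)"
  have "(\<Sum>l<t. ?e l * int (b ! l)) = 0" using i by (intro sum.neutral) auto
  moreover have "?e \<in> pullbacks t 0" using i by simp
  ultimately show ?thesis using pours_pullback[OF assms(1,3), of ?e 0] by auto
qed

text \<open>The subtraction is truncated, so the total is \<open>n\<close> only if the powers sum to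
  at most \<open>n\<close>; this hypothesis recurs below.\<close>

definition moment_state :: "nat \<Rightarrow> nat \<Rightarrow> nat \<Rightarrow> nat list" where
  "moment_state t n x = (n - (\<Sum>i=1..<t. x ^ i)) # map (\<lambda>i. x ^ i) [1..<t]"

lemma length_moment_state: "t \<ge> 1 \<Longrightarrow> length (moment_state t n x) = t"
  by (simp add: moment_state_def)

lemma sum_list_moment_state:
  "(\<Sum>i=1..<t. x ^ i) \<le> n \<Longrightarrow> sum_list (moment_state t n x) = n"
  by (simp add: moment_state_def sum_list_distinct_conv_sum_set)

text \<open>Expanding the first entry spreads \<open>- r 0\<close> over the coefficients of all
  positive powers and leaves \<open>r 0 * n\<close> as the constant term.\<close>

lemma functional_moment_state:
  fixes r :: "nat \<Rightarrow> int"
  assumes "(\<Sum>i=1..<Suc d. x ^ i) \<le> n"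
  shows "(\<Sum>i<Suc d. r i * int (moment_state (Suc d) n x ! i)) =
    (\<Sum>i\<le>d. (if i = 0 then r 0 * int n else r i - r 0) * int x ^ i)"
proof -
  have *: "(\<Sum>i=1..<Suc d. g i) = (\<Sum>i<d. g (Suc i))" for g :: "nat \<Rightarrow> 'a::comm_monoid_add"
    using sum.shift_bounds_Suc_ivl[of g 0 d] by (simp add: lessThan_atLeast0)
  have "(\<Sum>i<Suc d. r i * int (moment_state (Suc d) n x ! i)) =
      r 0 * int (n - (\<Sum>i<d. x ^ Suc i)) + (\<Sum>i<d. r (Suc i) * int x ^ Suc i)"
    unfolding sum.lessThan_Suc_shift moment_state_def * by (simp del: upt_Suc)
  also have "\<dots> = r 0 * int n + (\<Sum>i<d. (r (Suc i) - r 0) * int x ^ Suc i)"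
    using assms unfolding *
    by (simp add: of_nat_diff algebra_simps sum_subtractf sum_distrib_left)
  finally show ?thesis
    unfolding lessThan_Suc_atMost[symmetric] sum.lessThan_Suc_shift by simp
qed

lemma card_roots_moment_state:
  fixes r :: "nat \<Rightarrow> int"
  assumes "t \<ge> 1" "n > 0" "\<exists>i<t. r i \<noteq> 0"
    and le: "\<And>x. x \<in> X \<Longrightarrow> (\<Sum>i=1..<t. x ^ i) \<le> n"
  shows "card {x \<in> X. (\<Sum>i<t. r i * int (moment_state t n x ! i)) = 0} \<le> t"
proof -
  obtain d where t: "t = Suc d" using assms(1) by (cases t) auto
  let ?c = "\<lambda>i. if i = 0 then r 0 * int n else r i - r 0"
  let ?Z = "{z :: real. (\<Sum>i\<le>d. of_int (?c i) * z ^ i) = 0}"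
  let ?X = "{x \<in> X. (\<Sum>i<t. r i * int (moment_state t n x ! i)) = 0}"
  \<comment> \<open>If \<open>r 0 = 0\<close>, the positive-degree coefficients are the
    \<open>r i\<close> themselves, one of which is nonzero; otherwise the constant term
    \<open>r 0 * n\<close> is nonzero because \<open>n > 0\<close>.\<close>
  obtain k where k: "k \<le> d" "?c k \<noteq> 0"
  proof (cases "r 0 = 0")
    case True
    with assms(3) that t show ?thesis by (metis diff_zero less_Suc_eq_le)
  next
    case False
    with assms(2) that[of 0] show ?thesis by simp
  qed
  have "of_int (?c k) \<noteq> (0 :: real)" using k by (simp only: of_int_eq_0_iff not_False_eq_True)
  note Z = polyfun_rootbound[of "\<lambda>i. of_int (?c i) :: real" k d, OF this k(1)]
  have "real ` ?X \<subseteq> ?Z"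
  proof clarify
    fix x assume "x \<in> X" and 0: "(\<Sum>i<t. r i * int (moment_state t n x ! i)) = 0"
    then have "(\<Sum>i\<le>d. ?c i * int x ^ i) = 0"
      using functional_moment_state[of x d n r] le[of x] unfolding t by simp
    then have "real_of_int (\<Sum>i\<le>d. ?c i * int x ^ i) = 0" by (simp only: of_int_0)
    then show "(\<Sum>i\<le>d. of_int (?c i) * real x ^ i) = 0"
      by (simp only: of_int_sum of_int_mult of_int_power of_int_of_nat_eq)
  qed
  then have "card (real ` ?X) \<le> d" using Z card_mono le_trans by blast
  then show ?thesis by (simp add: card_image t)
qed

lemma exists_avoiding_state:
  assumes "t \<ge> 1" "n > 0" "\<And>x. x \<in> {..t ^ (2 * K + 2)} \<Longrightarrow> (\<Sum>i=1..<t. x ^ i) \<le> n"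
  shows "\<exists>x \<le> t ^ (2 * K + 2). \<forall>r \<in> pullbacks t K.
    (\<Sum>i<t. r i * int (moment_state t n x ! i)) \<noteq> 0"
proof (rule ccontr)
  \<comment> \<open>Counting from 0 gives \<open>t ^ (2 * K + 2) + 1\<close> candidates, one more
    than \<open>t ^ (2 * K + 1)\<close> functionals with at most \<open>t\<close> zeros each can
    exclude.\<close>
  let ?X = "{..t ^ (2 * K + 2)}"
  let ?B = "\<lambda>r. {x \<in> ?X. (\<Sum>i<t. r i * int (moment_state t n x ! i)) = 0}"
  assume "\<not> ?thesis"
  then have "?X \<subseteq> (\<Union>r \<in> pullbacks t K. ?B r)" by auto
  then have "card ?X \<le> card (\<Union>r \<in> pullbacks t K. ?B r)"
    by (intro card_mono) (simp_all add: finite_pullbacks)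
  also have "\<dots> \<le> (\<Sum>r \<in> pullbacks t K. card (?B r))"
    by (intro card_UN_le finite_pullbacks)
  also have "\<dots> \<le> (\<Sum>r \<in> pullbacks t K. t)"
    using assms by (intro sum_mono card_roots_moment_state pullbacks_nonzero) auto
  also have "\<dots> \<le> t ^ (2 * K + 1) * t" using card_pullbacks by simp
  also have "\<dots> = t ^ (2 * K + 2)" by simp
  finally show False by simp
qed

text \<open>Fewer than \<open>t\<close> summands, each at most \<open>(t ^ (2 * K + 2)) ^ t\<close>.
  This guarantees that the powers fit into the total \<open>n\<close> for every candidate
  \<open>x\<close>.\<close>

lemma sum_powers_le:
  fixes t x :: nat
  assumes "t \<ge> 1" "x \<le> t ^ (2 * K + 2)"
  shows "(\<Sum>i=1..<t. x ^ i) \<le> t ^ (1 + 2 * t + 2 * t * K)"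
proof -
  have "x ^ i \<le> (t ^ (2 * K + 2)) ^ t" if "i \<in> {1..<t}" for i
  proof -
    have "x ^ i \<le> (t ^ (2 * K + 2)) ^ i" using assms by (intro power_mono) auto
    also have "\<dots> \<le> (t ^ (2 * K + 2)) ^ t" using assms that by (intro power_increasing) auto
    finally show ?thesis .
  qed
  then have "(\<Sum>i=1..<t. x ^ i) \<le> card {1..<t} * (t ^ (2 * K + 2)) ^ t"
    using sum_bounded_above[of "{1..<t}" "\<lambda>i. x ^ i"] by simp
  also have "\<dots> \<le> t * (t ^ (2 * K + 2)) ^ t" by (intro mult_right_mono) auto
  also have "\<dots> = t ^ (1 + 2 * t + 2 * t * K)"
    by (simp add: power_mult[symmetric] power_add[symmetric] algebra_simps flip: power_Suc)
  finally show ?thesis .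
qed

theorem theorem30:
  fixes t :: nat
  assumes "t \<ge> 3"
  shows "\<exists>c::real. \<exists>n0::nat. c > 0 \<and>
           (\<forall>n \<ge> n0. \<exists>a :: nat list. length a = t \<and> sum_list a = n \<and>
              emptying_requires a (c * log 2 (real n)))"
proof -
  \<comment> \<open>Chosen so that \<open>K \<le> c * log 2 n\<close> yields
    \<open>t ^ (4 * t * K) \<le> n\<close>.\<close>
  define c where "c = 1 / (4 * real t * log 2 (real t))"
  define n0 where "n0 = t ^ (2 * (1 + 2 * t))"
  have logt: "log 2 (real t) > 0" using assms by simp
  have "c > 0" using assms logt unfolding c_def by simp
  moreover have "\<exists>a. length a = t \<and> sum_list a = n \<and> emptying_requires a (c * log 2 (real n))"
    if n: "n \<ge> n0" for n
  proof -
    define K where "K = nat \<lfloor>c * log 2 (real n)\<rfloor>"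
    have "n0 \<ge> 1" using assms unfolding n0_def by simp
    with n have n1: "n \<ge> 1" by simp
    then have K: "real K \<le> c * log 2 (real n)" using \<open>c > 0\<close> unfolding K_def by simp
    have tK: "t ^ (4 * t * K) \<le> n"
    proof -
      have "log 2 (real t ^ (4 * t * K)) = 4 * real t * log 2 (real t) * real K"
        using assms by (simp add: log_nat_power)
      also have "\<dots> \<le> 4 * real t * log 2 (real t) * (c * log 2 (real n))"
        using K logt by (intro mult_left_mono) auto
      also have "\<dots> = log 2 (real n)" using less_imp_neq[OF logt] assms unfolding c_def by (simp add: field_simps)
      finally have "real t ^ (4 * t * K) \<le> real n" using n1 assms by simp
      then show ?thesis by (metis of_nat_le_iff of_nat_power)
    qed
    \<comment> \<open>Squaring separates the bound of \<open>sum_powers_le\<close> into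
      \<open>n0\<close>, which is independent of \<open>K\<close>, and
      \<open>t ^ (4 * t * K)\<close>; each factor is at most \<open>n\<close>.\<close>
    have "(t ^ (1 + 2 * t + 2 * t * K))\<^sup>2 = n0 * t ^ (4 * t * K)"
      unfolding n0_def by (simp add: power_mult[symmetric] power_add[symmetric] algebra_simps flip: power_Suc)
    also have "\<dots> \<le> n\<^sup>2" using n tK unfolding power2_eq_square by (rule mult_mono) auto
    finally have "t ^ (1 + 2 * t + 2 * t * K) \<le> n" by (rule power2_le_imp_le) simp
    then have le: "(\<Sum>i=1..<t. x ^ i) \<le> n" if "x \<in> {..t ^ (2 * K + 2)}" for x
      using sum_powers_le[of t x K] that assms by (meson atMost_iff le_trans one_le_numeral)
    obtain x where x: "x \<le> t ^ (2 * K + 2)" and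
      nz: "\<forall>r \<in> pullbacks t K. (\<Sum>i<t. r i * int (moment_state t n x ! i)) \<noteq> 0"
      using exists_avoiding_state[of t n K] le n1 assms by auto
    let ?a = "moment_state t n x"
    have len: "length ?a = t" using assms by (intro length_moment_state) simp
    have "emptying_requires ?a (c * log 2 (real n))"
      unfolding emptying_requires_def
    proof (intro allI impI, rule ccontr)
      fix k b
      assume kb: "(pour ^^ k) ?a b" "has_empty_vessel b" and "\<not> c * log 2 (real n) \<le> real k"
      \<comment> \<open>A natural number below \<open>c * log 2 n\<close> is at most its floor
        \<open>K\<close>, so by monotonicity the one state chosen for \<open>K\<close> rules out all
        shorter runs too.\<close>
      then have "k \<le> K" unfolding K_def by linarith
      then show False
        using emptied_pullback[OF kb len] nz pullbacks_mono[of k K t] by blast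
    qed
    moreover have "sum_list ?a = n" using le x by (intro sum_list_moment_state) simp
    ultimately show ?thesis using len by blast
  qed
  ultimately show ?thesis by blast
qed

end
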